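(* Let $R$ be a commutative $\mathbb{Q}$-algebra and let $K$ be a totally real number field with Galois closure $L$ (over $\mathbb{Q}$). If $f \in R$ is a sum of $m$ squares in $R \otimes_{\mathbb{Q}} K$, then $f$ is a sum of $$4m \cdot 2^{[L:\mathbb{Q}]+1} \binom{[L:\mathbb{Q}]+1}{2}$$ squares over $R$.
   Context: A totally real number field is a finite algebraic extension of $\mathbb{Q}$ all of whose complex embeddings have image contained in $\mathbb{R}$. The ring $R\otimes_{\mathbb{Q}} K$ is regarded as a ring extension of $R = R\otimes_{\mathbb{Q}}\mathbb{Q}$ via $a\mapsto a\otimes 1$. An element $f$ is a sum of $N$ squares in (or over) a commutative ring $A$ if $f=\sum_{i=1}^N p_i^2$ with $p_i\in A$ (the $p_i$ may be zero). *)

theory Defs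
  imports
    Complex_Main
    "HOL-Library.Multiset"
    "HOL-Computational_Algebra.Computational_Algebra"
begin

text \<open>
  The class \<^class>\<open>comm_ring_1\<close> excludes the zero ring, so commutative rings with unit are
  rendered by the sort \<open>{comm_ring, comm_monoid_mult}\<close>, which has no axiom \<open>0 \<noteq> 1\<close>.
\<close>

class comm_rat_algebra = comm_ring + comm_monoid_mult +
  fixes scaleQ :: "rat \<Rightarrow> 'a \<Rightarrow> 'a"  (infixr \<open>*\<^sub>Q\<close> 75)
  assumes scaleQ_add_right: "q *\<^sub>Q (x + y) = q *\<^sub>Q x + q *\<^sub>Q y"
    and scaleQ_add_left: "(q + r) *\<^sub>Q x = q *\<^sub>Q x + r *\<^sub>Q x"
    and scaleQ_scaleQ: "q *\<^sub>Q r *\<^sub>Q x = (q * r) *\<^sub>Q x"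
    and scaleQ_one: "1 *\<^sub>Q x = x"
    and scaleQ_mult_left: "(q *\<^sub>Q x) * y = q *\<^sub>Q (x * y)"

definition is_sum_of_squares :: "nat \<Rightarrow> 'a::{comm_ring, comm_monoid_mult} \<Rightarrow> bool" where
  "is_sum_of_squares N f \<longleftrightarrow> (\<exists>p :: nat \<Rightarrow> 'a. f = (\<Sum>i<N. (p i)\<^sup>2))"


section \<open>The tensor product over the rationals of a commutative algebra and a field\<close>

text \<open>
  A multiset of pairs stands for the formal sum of the tensors \<open>a \<otimes> k\<close>.  Taking the free
  commutative monoid on the pairs instead of the free abelian group gives the same quotient:
  \<open>tensor_zero\<close> makes every \<open>0 \<otimes> k\<close> vanish, so that \<open>(- a) \<otimes> k\<close> is a negative of \<open>a \<otimes> k\<close>.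
  The action of a rational \<open>q\<close> on the field is multiplication by \<open>of_rat q\<close>.
\<close>

inductive tensor_eq ::
  "('r::comm_rat_algebra \<times> 'k::field_char_0) multiset \<Rightarrow> ('r \<times> 'k) multiset \<Rightarrow> bool" where
  tensor_refl: "tensor_eq X X"
| tensor_sym: "tensor_eq X Y \<Longrightarrow> tensor_eq Y X"
| tensor_trans: "tensor_eq X Y \<Longrightarrow> tensor_eq Y Z \<Longrightarrow> tensor_eq X Z"
| tensor_cong: "tensor_eq X Y \<Longrightarrow> tensor_eq (X + Z) (Y + Z)"
| tensor_zero: "tensor_eq {#(0, k)#} {#}"
| tensor_add_left: "tensor_eq {#(a + b, k)#} {#(a, k), (b, k)#}"
| tensor_add_right: "tensor_eq {#(a, k + l)#} {#(a, k), (a, l)#}"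
| tensor_scale: "tensor_eq {#(q *\<^sub>Q a, k)#} {#(a, of_rat q * k)#}"

lemma tensor_cong2: "tensor_eq X X' \<Longrightarrow> tensor_eq Y Y' \<Longrightarrow> tensor_eq (X + Y) (X' + Y')"
  using tensor_trans[of "X + Y" "X' + Y" "X' + Y'"] tensor_cong[of X X' Y] tensor_cong[of Y Y' X']
  by (simp add: add.commute)

quotient_type (overloaded) ('r, 'k) tensor =
  "('r::comm_rat_algebra \<times> 'k::field_char_0) multiset" / tensor_eq
  by (intro equivpI reflpI sympI transpI) (fact tensor_refl tensor_sym tensor_trans)+

lift_definition tensor_of :: "'r::comm_rat_algebra \<Rightarrow> 'k::field_char_0 \<Rightarrow> ('r, 'k) tensor"
    (infix \<open>\<otimes>\<^sub>Q\<close> 76)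
  is "\<lambda>a k. {#(a, k)#}" .

definition tensor_mult1 ::
  "'r::comm_rat_algebra \<times> 'k::field_char_0 \<Rightarrow> ('r \<times> 'k) multiset \<Rightarrow> ('r \<times> 'k) multiset" where
  "tensor_mult1 x Y = image_mset (\<lambda>y. (fst x * fst y, snd x * snd y)) Y"

definition tensor_mult ::
  "('r::comm_rat_algebra \<times> 'k::field_char_0) multiset \<Rightarrow> ('r \<times> 'k) multiset \<Rightarrow> ('r \<times> 'k) multiset"
  where "tensor_mult X Y = (\<Sum>x\<in>#X. tensor_mult1 x Y)"

lemma tensor_mult_simps [simp]:
  "tensor_mult {#} Y = {#}"
  "tensor_mult (add_mset x X) Y = tensor_mult1 x Y + tensor_mult X Y"
  "tensor_mult (X + X') Y = tensor_mult X Y + tensor_mult X' Y"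
  by (simp_all add: tensor_mult_def)

lemma tensor_mult1_simps [simp]:
  "tensor_mult1 x {#} = {#}"
  "tensor_mult1 x (add_mset y Y) = add_mset (fst x * fst y, snd x * snd y) (tensor_mult1 x Y)"
  "tensor_mult1 x (Y + Y') = tensor_mult1 x Y + tensor_mult1 x Y'"
  by (simp_all add: tensor_mult1_def)

lemma tensor_mult_empty_right [simp]: "tensor_mult X {#} = {#}"
  by (induction X) auto

lemma tensor_mult_add_right [simp]:
  "tensor_mult X (Y + Y') = tensor_mult X Y + tensor_mult X Y'"
  by (induction X) (auto simp: ac_simps)

lemma tensor_mult_add_mset_right:
  "tensor_mult X (add_mset y Y) = tensor_mult X {#y#} + tensor_mult X Y"
  using tensor_mult_add_right[of X "{#y#}" Y] by simp

lemma tensor_mult_commute: "tensor_mult X Y = tensor_mult Y X"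
proof (induction X)
  case (add x X)
  have "tensor_mult1 x Y = tensor_mult Y {#x#}"
    by (induction Y) (auto simp: ac_simps)
  with add show ?case using tensor_mult_add_mset_right[of Y x X] by simp
qed simp

lemma tensor_mult_assoc:
  "tensor_mult (tensor_mult X Y) Z = tensor_mult X (tensor_mult Y Z)"
proof (induction X)
  case (add x X)
  have "tensor_mult (tensor_mult1 x Y) Z = tensor_mult1 x (tensor_mult Y Z)"
  proof (induction Y)
    case (add y Y)
    have "tensor_mult1 (fst x * fst y, snd x * snd y) Z = tensor_mult1 x (tensor_mult1 y Z)"
      by (induction Z) (auto simp: ac_simps)
    with add show ?case by simp
  qed simp
  with add show ?case by simp
qed simp

lemma scaleQ_mult_right: "x * (q *\<^sub>Q y) = q *\<^sub>Q (x * y :: 'a::comm_rat_algebra)"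
  using scaleQ_mult_left[of q y x] by (simp add: mult.commute)

lemma tensor_mult1_cong:
  "tensor_eq Y Y' \<Longrightarrow> tensor_eq (tensor_mult1 x Y) (tensor_mult1 x Y')"
proof (induction rule: tensor_eq.induct)
  case (tensor_trans X Y Z)
  from tensor_trans.IH show ?case by (rule tensor_eq.tensor_trans)
next
  case (tensor_sym X Y)
  from tensor_sym.IH show ?case by (rule tensor_eq.tensor_sym)
next
  case (tensor_scale q a k)
  have "tensor_eq {#(q *\<^sub>Q (fst x * a), snd x * k)#} {#(fst x * a, of_rat q * (snd x * k))#}"
    by (rule tensor_eq.tensor_scale)
  then show ?case by (simp add: scaleQ_mult_right ac_simps)
qed (simp_all add: distrib_left tensor_refl tensor_cong tensor_zero tensor_add_left tensor_add_right)

lemma tensor_mult_cong_right: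
  "tensor_eq Y Y' \<Longrightarrow> tensor_eq (tensor_mult X Y) (tensor_mult X Y')"
  by (induction X) (simp_all add: tensor_cong2 tensor_mult1_cong tensor_refl)

lemma tensor_mult_cong:
  "tensor_eq X X' \<Longrightarrow> tensor_eq Y Y' \<Longrightarrow> tensor_eq (tensor_mult X Y) (tensor_mult X' Y')"
  using tensor_trans[of "tensor_mult X Y" "tensor_mult X Y'" "tensor_mult X' Y'"]
    tensor_mult_cong_right[of Y Y' X] tensor_mult_cong_right[of X X' Y']
  by (simp add: tensor_mult_commute)

lemma tensor_uminus_cong:
  assumes "tensor_eq X Y"
  shows "tensor_eq (image_mset (map_prod uminus id) X) (image_mset (map_prod uminus id) Y)"
proof -
  have eq: "image_mset (map_prod uminus id) X = tensor_mult1 (- 1, 1) X"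
    for X :: "('a \<times> 'b) multiset"
    by (induction X) (auto simp: map_prod_def)
  show ?thesis unfolding eq by (rule tensor_mult1_cong[OF assms])
qed

lemma tensor_uminus_add: "tensor_eq (image_mset (map_prod uminus id) X + X) {#}"
proof (induction X)
  case (add x X)
  have "tensor_eq {#(- fst x, snd x), (fst x, snd x)#} {#}"
    using tensor_trans[OF tensor_sym[OF tensor_add_left[of "- fst x" "fst x" "snd x"]]]
      tensor_zero[of "snd x"] by simp
  from tensor_cong2[OF this add] show ?case
    by (cases x) (simp add: add_mset_commute)
qed (auto intro: tensor_refl)

instantiation tensor :: (comm_rat_algebra, field_char_0) "{comm_ring, comm_monoid_mult}"
begin

lift_definition zero_tensor :: "('a, 'b) tensor" is "{#}" .
lift_definition one_tensor :: "('a, 'b) tensor" is "{#(1, 1)#}" .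
lift_definition plus_tensor :: "('a, 'b) tensor \<Rightarrow> ('a, 'b) tensor \<Rightarrow> ('a, 'b) tensor"
  is "(+)" by (rule tensor_cong2)
lift_definition uminus_tensor :: "('a, 'b) tensor \<Rightarrow> ('a, 'b) tensor"
  is "image_mset (map_prod uminus id)" by (rule tensor_uminus_cong)
lift_definition times_tensor :: "('a, 'b) tensor \<Rightarrow> ('a, 'b) tensor \<Rightarrow> ('a, 'b) tensor"
  is tensor_mult by (rule tensor_mult_cong)
definition minus_tensor :: "('a, 'b) tensor \<Rightarrow> ('a, 'b) tensor \<Rightarrow> ('a, 'b) tensor"
  where "minus_tensor x y = x + (- y)"

instance
proof
  fix a b c :: "('a, 'b) tensor"
  show "a + b + c = a + (b + c)" by transfer (simp add: ac_simps tensor_refl)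
  show "a + b = b + a" by transfer (simp add: ac_simps tensor_refl)
  show "0 + a = a" by transfer (simp add: tensor_refl)
  show "- a + a = 0" by transfer (rule tensor_uminus_add)
  show "a - b = a + - b" by (rule minus_tensor_def)
  show "a * b * c = a * (b * c)" by transfer (simp add: tensor_mult_assoc tensor_refl)
  show "a * b = b * a" by transfer (simp add: tensor_mult_commute tensor_refl)
  show "(a + b) * c = a * c + b * c" by transfer (simp add: tensor_refl)
  show "1 * a = a" by transfer (simp add: tensor_mult1_def tensor_refl)
qed

end


section \<open>Totally real number fields and Galois closures\<close>

interpretation rat_vec: vector_space "\<lambda>q (x :: 'a::field_char_0). of_rat q * x"
  by unfold_locales (auto simp: algebra_simps of_rat_add of_rat_mult)

definition finite_over_rat :: "'a::field_char_0 set \<Rightarrow> bool" where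
  "finite_over_rat F \<longleftrightarrow> (\<exists>B. finite B \<and> rat_vec.span B = F)"

definition rat_degree :: "'a::field_char_0 itself \<Rightarrow> nat" where
  "rat_degree _ = rat_vec.dim (UNIV :: 'a set)"

definition is_field_hom :: "('a::field \<Rightarrow> 'b::field) \<Rightarrow> bool" where
  "is_field_hom h \<longleftrightarrow>
     h 1 = 1 \<and> (\<forall>x y. h (x + y) = h x + h y) \<and> (\<forall>x y. h (x * y) = h x * h y)"

definition totally_real_number_field :: "'k::field_char_0 itself \<Rightarrow> bool" where
  "totally_real_number_field _ \<longleftrightarrow>
     finite_over_rat (UNIV :: 'k set) \<and>
     (\<forall>\<sigma> :: 'k \<Rightarrow> complex. is_field_hom \<sigma> \<longrightarrow> range \<sigma> \<subseteq> \<real>)"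

definition is_subfield :: "'a::field set \<Rightarrow> bool" where
  "is_subfield F \<longleftrightarrow>
     1 \<in> F \<and> (\<forall>x\<in>F. \<forall>y\<in>F. x - y \<in> F \<and> x * y \<in> F) \<and> (\<forall>x\<in>F. inverse x \<in> F)"

text \<open>
  Since \<open>A\<close> below is a set, the linear factors are distinct; the last conjunct thus expresses
  normality and separability at the same time.
\<close>

definition galois_over_rat :: "'a::field_char_0 set \<Rightarrow> bool" where
  "galois_over_rat F \<longleftrightarrow>
     is_subfield F \<and> finite_over_rat F \<and>
     (\<forall>p :: rat poly. irreducible p \<and> (\<exists>x\<in>F. poly (map_poly of_rat p) x = 0) \<longrightarrow>
        (\<exists>c A. finite A \<and> A \<subseteq> F \<and> map_poly of_rat p = smult c (\<Prod>a\<in>A. [:- a, 1:])))"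

definition is_galois_closure :: "('k::field_char_0 \<Rightarrow> 'l::field_char_0) \<Rightarrow> bool" where
  "is_galois_closure \<iota> \<longleftrightarrow>
     is_field_hom \<iota> \<and> galois_over_rat (UNIV :: 'l set) \<and>
     (\<forall>F. galois_over_rat F \<and> range \<iota> \<subseteq> F \<longrightarrow> F = UNIV)"

end

theory Submission
  imports Defs "Jordan_Normal_Form.Schur_Decomposition"
begin

text \<open>
  Let \<open>d = [K : \<rat>]\<close>.  The eigenvalues of multiplication by \<open>x\<close> on \<open>K\<close> are values at \<open>x\<close> of
  embeddings of \<open>K\<close> into the complex numbers, hence real, so the normalised trace \<open>l = tr / d\<close> is a
  rational functional with \<open>l 1 = 1\<close> and \<open>l (x\<^sup>2) \<ge> 0\<close>.  Diagonalise the form \<open>l (x y)\<close> over the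
  rationals by an orthogonal basis \<open>C\<close>.  Applying \<open>id \<otimes> l\<close> to the square of \<open>\<Sum>c\<in>C. r c \<otimes> c\<close> gives
  \<open>\<Sum>c\<in>C. l (c\<^sup>2) (r c)\<^sup>2\<close>, and each \<open>l (c\<^sup>2)\<close> is a sum of four rational squares.  So \<open>f\<close> is a
  sum of \<open>4 m d\<close> squares, which is at most the stated number because \<open>d \<le> [L : \<rat>]\<close>.
\<close>

section \<open>Sums of four rational squares\<close>

definition sums_of_four_squares :: "rat set" where
  "sums_of_four_squares = {a\<^sup>2 + b\<^sup>2 + c\<^sup>2 + d\<^sup>2 | a b c d. True}"

lemma four_squaresI: "a\<^sup>2 + b\<^sup>2 + c\<^sup>2 + d\<^sup>2 \<in> sums_of_four_squares"
  unfolding sums_of_four_squares_def by blast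

text \<open>Euler's four-square identity, that is, multiplicativity of the quaternion norm.\<close>

lemma four_squares_mult:
  assumes "x \<in> sums_of_four_squares" "y \<in> sums_of_four_squares"
  shows "x * y \<in> sums_of_four_squares"
proof -
  obtain a b c d where x: "x = a\<^sup>2 + b\<^sup>2 + c\<^sup>2 + d\<^sup>2"
    using assms(1) unfolding sums_of_four_squares_def by blast
  obtain e f g h where y: "y = e\<^sup>2 + f\<^sup>2 + g\<^sup>2 + h\<^sup>2"
    using assms(2) unfolding sums_of_four_squares_def by blast
  have "x * y = (a * e - b * f - c * g - d * h)\<^sup>2 + (a * f + b * e + c * h - d * g)\<^sup>2
      + (a * g - b * h + c * e + d * f)\<^sup>2 + (a * h + b * g - c * f + d * e)\<^sup>2"
    unfolding x y by (simp add: power2_eq_square algebra_simps)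
  then show ?thesis by (simp add: four_squaresI)
qed

text \<open>For nonzero \<open>x\<close>, the inverse is \<open>x\<close> times the square of
  \<open>inverse x\<close>.\<close>

lemma four_squares_inverse:
  assumes "x \<in> sums_of_four_squares"
  shows "inverse x \<in> sums_of_four_squares"
proof (cases "x = 0")
  case False
  have "(inverse x)\<^sup>2 \<in> sums_of_four_squares"
    using four_squaresI[of "inverse x" 0 0 0] by simp
  from four_squares_mult[OF assms this] False show ?thesis
    by (simp add: power2_eq_square field_simps)
qed (use assms in simp)

text \<open>Pigeonhole: for \<open>x\<close> from 0 to \<open>p div 2\<close>, the residues of
  \<open>x^2\<close> and of \<open>-1 - x^2\<close> form two sets of (p + 1) / 2 elements each.
  There are only \<open>p\<close> residues, so the sets meet. The half range gives both injectivity
  and the size bounds.\<close>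

lemma prime_dvd_sum_two_squares_plus_1:
  fixes p :: nat
  assumes "prime p" "odd p"
  obtains a b :: int where "0 \<le> a" "2 * a < int p" "0 \<le> b" "2 * b < int p"
    "int p dvd a\<^sup>2 + b\<^sup>2 + 1"
proof -
  define A where "A = {0..int (p div 2)}"
  have p: "prime (int p)" "2 * int (p div 2) + 1 = int p"
    using assms by (auto elim!: oddE)
  \<comment> \<open>Both \<open>x - y\<close> and \<open>x + y\<close> have absolute value below
    \<open>p\<close>, so the one divisible by \<open>p\<close> is zero; a vanishing sum makes both
    numbers zero.\<close>
  have inj: "x = y" if "x \<in> A" "y \<in> A" "int p dvd x\<^sup>2 - y\<^sup>2" for x y
  proof -
    have "int p dvd (x - y) * (x + y)"
      using that by (simp add: power2_eq_square algebra_simps)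
    then consider "int p dvd x - y" | "int p dvd x + y"
      using p(1) prime_dvd_mult_iff by blast
    then show ?thesis
    proof cases
      case 1
      then show ?thesis
        using that p(2) zdvd_not_zless[of "x - y" "int p"] zdvd_not_zless[of "y - x" "int p"]
          dvd_diff_commute[of "int p" x y]
        unfolding A_def by fastforce
    next
      case 2
      then show ?thesis
        using that p(2) zdvd_not_zless[of "x + y" "int p"] unfolding A_def by fastforce
    qed
  qed
  let ?f = "\<lambda>x. x\<^sup>2 mod int p" and ?g = "\<lambda>x. (- 1 - x\<^sup>2) mod int p"
  have "inj_on ?f A"
    by (intro inj_onI inj) (auto simp: mod_eq_dvd_iff)
  moreover have "inj_on ?g A"
  proof (intro inj_onI)
    fix x y assume xy: "x \<in> A" "y \<in> A" "?g x = ?g y"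
    then have "int p dvd y\<^sup>2 - x\<^sup>2" by (simp add: mod_eq_dvd_iff algebra_simps)
    with xy show "x = y" using inj[of y x] by simp
  qed
  moreover have "card A = p div 2 + 1" "finite A" by (simp_all add: A_def)
  ultimately have card: "card (?f ` A) = p div 2 + 1" "card (?g ` A) = p div 2 + 1"
    and fin: "finite (?f ` A)" "finite (?g ` A)"
    by (simp_all add: card_image)
  have "?f ` A \<inter> ?g ` A \<noteq> {}"
  proof
    assume "?f ` A \<inter> ?g ` A = {}"
    with fin card have "card (?f ` A \<union> ?g ` A) = 2 * (p div 2 + 1)"
      by (simp add: card_Un_disjoint)
    moreover have "card (?f ` A \<union> ?g ` A) \<le> card {0..<int p}"
      using p by (intro card_mono) (auto simp: prime_gt_0_int)
    ultimately show False using p(2) by simp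
  qed
  then obtain a b where "a \<in> A" "b \<in> A" "?f a = ?g b" by auto
  then show thesis
    using that[of a b] p(2) by (auto simp: mod_eq_dvd_iff A_def algebra_simps)
qed

text \<open>
  Over the rationals no descent is needed: if \<open>a\<^sup>2 + b\<^sup>2 + 1 = p m\<close> with \<open>m < p\<close>, then \<open>m\<close> and hence
  \<open>1 / m\<close> are products of four-square sums by induction.
\<close>

lemma prime_four_squares:
  assumes "prime (p :: nat)"
  shows "of_nat p \<in> sums_of_four_squares"
  using assms
proof (induction p rule: less_induct)
  case (less p)
  note outer_IH = less.IH
  \<comment> \<open>Every prime factor of \<open>m\<close> is below \<open>p\<close>, so
    \<open>outer_IH\<close> covers it; the inner induction handles the cofactor.\<close>
  have small: "of_nat m \<in> sums_of_four_squares" if "0 < m" "m < p" for m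
    using that
  proof (induction m rule: less_induct)
    case (less m)
    show ?case
    proof (cases "m = 1")
      case True
      then show ?thesis using four_squaresI[of 1 0 0 0] by simp
    next
      case False
      then obtain q where q: "prime q" "q dvd m" using prime_factor_nat by blast
      then obtain k where k: "m = q * k" by auto
      with less.prems q have "0 < k" "k < m" "q \<le> m"
        by (auto simp: prime_gt_Suc_0_nat dvd_imp_le)
      with less have "of_nat q \<in> sums_of_four_squares" "of_nat k \<in> sums_of_four_squares"
        using outer_IH[of q] q(1) by auto
      with k show ?thesis by (simp add: four_squares_mult)
    qed
  qed
  show ?case
  proof (cases "odd p")
    case False
    with less.prems have "p = 2" using primes_dvd_imp_eq two_is_prime_nat by blast
    then show ?thesis using four_squaresI[of 1 1 0 0] by simp
  next
    case True
    obtain a b where ab: "0 \<le> a" "2 * a < int p" "0 \<le> b" "2 * b < int p"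
      and dvd: "int p dvd a\<^sup>2 + b\<^sup>2 + 1"
      using prime_dvd_sum_two_squares_plus_1[OF less.prems True] by blast
    then obtain m where m: "a\<^sup>2 + b\<^sup>2 + 1 = int p * m" by auto
    have p1: "int p > 1" using prime_gt_1_nat[OF less.prems] by simp
    \<comment> \<open>As \<open>a\<close> and \<open>b\<close> are at most (p - 1) / 2, the multiple
      \<open>p * m\<close> stays below \<open>p^2\<close>, hence \<open>m < p\<close>.\<close>
    have "(2 * a)\<^sup>2 \<le> (int p - 1)\<^sup>2" "(2 * b)\<^sup>2 \<le> (int p - 1)\<^sup>2"
      by (rule power_mono; use ab in linarith)+
    then have "4 * (int p * m) \<le> 2 * (int p - 1)\<^sup>2 + 4"
      unfolding m[symmetric] by (simp add: power2_eq_square)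
    also have "\<dots> < 4 * (int p * int p)"
      using p1 mult_strict_mono[of 1 "int p" 1 "int p"]
      by (simp add: power2_eq_square algebra_simps)
    finally have "m < int p" using p1 by simp
    moreover have "m > 0"
    proof -
      have "int p * m > 0" unfolding m[symmetric] by (simp add: add_nonneg_pos)
      then show ?thesis using p1 by (simp add: zero_less_mult_iff)
    qed
    \<comment> \<open>It remains to write \<open>p\<close> as the quotient of
      \<open>a^2 + b^2 + 1\<close> by \<open>m\<close>.\<close>
    ultimately have "inverse (of_nat (nat m)) \<in> sums_of_four_squares"
      by (intro four_squares_inverse small) auto
    moreover have "(of_int (a\<^sup>2 + b\<^sup>2 + 1) :: rat) \<in> sums_of_four_squares"
      using four_squaresI[of "of_int a" "of_int b" 1 0] by simp
    ultimately have "of_int (int p * m) * inverse (of_nat (nat m)) \<in> sums_of_four_squares"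
      unfolding m by (intro four_squares_mult)
    with \<open>m > 0\<close> show ?thesis by (simp add: field_simps)
  qed
qed

text \<open>Prime factorisation reduces natural numbers to primes; a fraction is then a numerator
  times the inverse of a denominator.\<close>

lemma nonneg_rat_four_squares:
  assumes "0 \<le> (q :: rat)"
  obtains a b c d where "q = a\<^sup>2 + b\<^sup>2 + c\<^sup>2 + d\<^sup>2"
proof -
  have nat: "of_nat n \<in> sums_of_four_squares" for n
  proof (induction n rule: prime_divisors_induct)
    case zero
    then show ?case using four_squaresI[of 0 0 0 0] by simp
  next
    case (unit n)
    then show ?case using four_squaresI[of 1 0 0 0] by simp
  next
    case (factor p n)
    then show ?case by (simp add: four_squares_mult prime_four_squares)
  qed
  obtain u v where "quotient_of q = (u, v)" by fastforce
  then have "q = of_int u / of_int v" "v > 0"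
    by (simp_all add: quotient_of_div quotient_of_denom_pos)
  with assms have "q = of_nat (nat u) * inverse (of_nat (nat v))"
    by (simp add: field_simps zero_le_divide_iff)
  then have "q \<in> sums_of_four_squares"
    by (simp add: nat four_squares_mult four_squares_inverse)
  then show thesis using that unfolding sums_of_four_squares_def by blast
qed

section \<open>Embeddings from eigenfunctionals\<close>

text \<open>Rational linearity follows from additivity, through naturals, integers and clearing the
  denominator. Functionals can therefore be carried along as merely \<open>additive\<close>.\<close>

lemma additive_of_rat_mult:
  fixes h :: "'a::field_char_0 \<Rightarrow> 'b::field_char_0"
  assumes "additive h"
  shows "h (of_rat q * x) = of_rat q * h x"
proof -
  interpret additive h by fact
  have nat: "h (of_nat n * y) = of_nat n * h y" for n y
    by (induction n) (simp_all add: algebra_simps add zero)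
  have int: "h (of_int k * y) = of_int k * h y" for k y
    by (cases k) (simp_all add: nat minus del: of_nat_Suc)
  obtain u v where "quotient_of q = (u, v)" by fastforce
  then have q: "q = of_int u / of_int v" and v: "v \<noteq> 0"
    using quotient_of_denom_pos by (auto simp: quotient_of_div)
  have "of_int v * h (of_rat q * x) = h (of_int v * (of_rat q * x))" by (simp add: int)
  also have "of_int v * (of_rat q * x) = of_int u * x"
    using v by (simp add: q of_rat_divide)
  also have "h (of_int u * x) = of_int v * (of_rat q * h x)"
    using v by (simp add: int q of_rat_divide)
  finally show ?thesis using v by simp
qed

text \<open>A space spanned by \<open>N\<close> elements has no \<open>N + 1\<close> independent
  vectors, so the powers of \<open>y\<close> up to \<open>N\<close> satisfy a relation.\<close>

lemma finite_over_rat_algebraic: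
  fixes y :: "'a::field_char_0"
  assumes "finite_over_rat (UNIV :: 'a set)"
  obtains c :: "nat \<Rightarrow> rat" and N where "\<exists>i\<le>N. c i \<noteq> 0" "(\<Sum>i\<le>N. of_rat (c i) * y ^ i) = 0"
proof -
  obtain B :: "'a set" where B: "finite B" "rat_vec.span B = UNIV"
    using assms unfolding finite_over_rat_def by blast
  define N where "N = card B"
  show thesis
  \<comment> \<open>Dependence concerns the set of powers, in which coinciding powers merge; in that
    case the relation is the difference of two equal powers.\<close>
  proof (cases "inj_on (\<lambda>i. y ^ i) {..N}")
    case True
    let ?S = "(\<lambda>i. y ^ i) ` {..N}"
    have "card ?S = Suc N" using True by (simp add: card_image)
    then have "rat_vec.dependent ?S"
      using rat_vec.independent_span_bound[of B ?S] B N_def by auto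
    then obtain u where u: "\<exists>v\<in>?S. u v \<noteq> 0" "(\<Sum>v\<in>?S. of_rat (u v) * v) = 0"
      by (subst (asm) rat_vec.dependent_finite) auto
    show thesis
      by (rule that[of N "\<lambda>i. u (y ^ i)"]) (use u True in \<open>auto simp: sum.reindex\<close>)
  next
    case False
    then obtain i j where ij: "i \<noteq> j" "i \<le> N" "j \<le> N" "y ^ i = y ^ j"
      by (auto simp: inj_on_def)
    let ?c = "\<lambda>k. (if k = i then 1 else 0) - (if k = j then 1 else 0) :: rat"
    have "(\<Sum>k\<le>N. of_rat (?c k) * y ^ k)
        = (\<Sum>k\<le>N. if k = i then y ^ k else 0) - (\<Sum>k\<le>N. if k = j then y ^ k else 0)"
      unfolding sum_subtractf[symmetric]
      by (intro sum.cong) (auto simp: of_rat_diff)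
    then show thesis using ij by (intro that[of N ?c]) auto
  qed
qed

text \<open>
  The sums below are \<open>p(T) \<phi>\<close> for the operator \<open>(T \<phi>) z = \<phi> (y * z)\<close>.  If \<open>p(T)\<close> kills \<open>\<phi>\<close>, stripping
  linear factors off \<open>p\<close> until the result is nonzero leaves an eigenvector of \<open>T\<close>.
\<close>

lemma eigenfunctional_of_annihilator:
  fixes \<phi> :: "'a::comm_ring_1 \<Rightarrow> complex" and p :: "complex poly"
  assumes "p \<noteq> 0" "\<phi> x \<noteq> 0" "\<And>z. (\<Sum>i\<le>degree p. coeff p i * \<phi> (y ^ i * z)) = 0"
  shows "\<exists>g s. (\<exists>z. (\<Sum>i\<le>degree g. coeff g i * \<phi> (y ^ i * z)) \<noteq> 0) \<and>
    (\<forall>z. (\<Sum>i\<le>degree g. coeff g i * \<phi> (y ^ i * (y * z))) =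
         s * (\<Sum>i\<le>degree g. coeff g i * \<phi> (y ^ i * z)))"
  using assms
proof (induction "degree p" arbitrary: p rule: less_induct)
  case less
  have "degree p \<noteq> 0"
  proof
    assume "degree p = 0"
    then obtain a where "p = [:a:]" by (rule degree_eq_zeroE)
    with less.prems(3)[of x] less.prems(1,2) show False by simp
  qed
  then obtain s where "poly p s = 0"
    using fundamental_theorem_of_algebra[of p] constant_degree[of p] by auto
  then obtain g where p: "p = [:- s, 1:] * g" by (auto simp: poly_eq_0_iff_dvd)
  with less.prems(1) have g: "g \<noteq> 0" by auto
  then have deg: "degree p = Suc (degree g)" by (simp add: p degree_mult_eq del: mult_pCons_left)
  have "(\<Sum>i\<le>degree p. coeff p i * \<phi> (y ^ i * z)) =
      (\<Sum>i\<le>degree g. coeff g i * \<phi> (y ^ i * (y * z))) -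
      s * (\<Sum>i\<le>degree g. coeff g i * \<phi> (y ^ i * z))" for z
  proof -
    have c: "coeff p i = coeff (pCons 0 g) i - s * coeff g i" for i
      by (simp add: p)
    \<comment> \<open>Multiplying \<open>g\<close> by the variable shifts its coefficients by one,
      which turns the argument \<open>z\<close> into \<open>y * z\<close>.\<close>
    have "(\<Sum>i\<le>degree p. coeff (pCons 0 g) i * \<phi> (y ^ i * z)) =
        (\<Sum>i\<le>degree g. coeff g i * \<phi> (y ^ i * (y * z)))"
      unfolding deg by (subst sum.atMost_Suc_shift) (simp add: mult_ac)
    moreover have "(\<Sum>i\<le>degree p. s * coeff g i * \<phi> (y ^ i * z)) =
        s * (\<Sum>i\<le>degree g. coeff g i * \<phi> (y ^ i * z))"
      unfolding deg by (simp add: coeff_eq_0 sum_distrib_left mult_ac)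
    ultimately show ?thesis by (simp add: c left_diff_distrib sum_subtractf)
  qed
  with less.prems(3) have eigen: "(\<Sum>i\<le>degree g. coeff g i * \<phi> (y ^ i * (y * z))) =
      s * (\<Sum>i\<le>degree g. coeff g i * \<phi> (y ^ i * z))" for z
    by simp
  show ?case
  proof (cases "\<forall>z. (\<Sum>i\<le>degree g. coeff g i * \<phi> (y ^ i * z)) = 0")
    case True
    then show ?thesis using less.hyps[of g] less.prems(2) g deg by simp
  next
    case False
    with eigen show ?thesis by blast
  qed
qed

text \<open>Multiplication operators commute, so treating the elements of \<open>B\<close> one after
  another preserves the eigenvalues already obtained. The last conjunct passes prescribed
  eigenvalues of \<open>\<phi>\<close> on to \<open>\<psi>\<close>.\<close>

lemma common_eigenfunctional:
  fixes \<phi> :: "'k::field_char_0 \<Rightarrow> complex"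
  assumes fin: "finite_over_rat (UNIV :: 'k set)" and "finite B"
    and "additive \<phi>" "\<phi> x \<noteq> 0"
  shows "\<exists>\<psi>. additive \<psi> \<and> (\<exists>z. \<psi> z \<noteq> 0) \<and> (\<forall>b\<in>B. \<exists>s. \<forall>z. \<psi> (b * z) = s * \<psi> z) \<and>
    (\<forall>y s. (\<forall>z. \<phi> (y * z) = s * \<phi> z) \<longrightarrow> (\<forall>z. \<psi> (y * z) = s * \<psi> z))"
  using \<open>finite B\<close>
proof (induction B rule: finite_induct)
  case empty
  show ?case using assms(3,4) by (intro exI[of _ \<phi>]) auto
next
  case (insert b B)
  then obtain \<psi> x where \<psi>: "additive \<psi>" "\<psi> x \<noteq> 0" "\<forall>b\<in>B. \<exists>s. \<forall>z. \<psi> (b * z) = s * \<psi> z"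
    "\<forall>y s. (\<forall>z. \<phi> (y * z) = s * \<phi> z) \<longrightarrow> (\<forall>z. \<psi> (y * z) = s * \<psi> z)" by blast
  interpret additive \<psi> by fact
  obtain c N where c: "\<exists>i\<le>N. c i \<noteq> 0" "(\<Sum>i\<le>N. of_rat (c i) * b ^ i) = 0"
    using finite_over_rat_algebraic[OF fin, where y = b] .
  \<comment> \<open>The algebraic relation for \<open>b\<close>, read over the complex numbers.
    Applied as an operator to \<open>\<psi>\<close>, it multiplies the argument by the value of the
    relation at \<open>b\<close>, which is zero.\<close>
  define p :: "complex poly" where "p = (\<Sum>i\<le>N. monom (of_rat (c i)) i)"
  have coeff: "coeff p i = (if i \<le> N then of_rat (c i) else 0)" for i
    by (simp add: p_def coeff_sum if_distrib cong: if_cong)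
  have "p \<noteq> 0"
  proof -
    obtain i where "i \<le> N" "c i \<noteq> 0" using c(1) by blast
    then have "coeff p i \<noteq> 0" by (simp add: coeff)
    then show ?thesis by auto
  qed
  have "degree p \<le> N" using coeff by (intro degree_le) auto
  then have "(\<Sum>i\<le>degree p. coeff p i * \<psi> (b ^ i * z)) = 0" for z
  proof -
    have "(\<Sum>i\<le>degree p. coeff p i * \<psi> (b ^ i * z)) = (\<Sum>i\<le>N. coeff p i * \<psi> (b ^ i * z))"
      using \<open>degree p \<le> N\<close> by (intro sum.mono_neutral_left) (auto simp: coeff_eq_0)
    also have "\<dots> = \<psi> ((\<Sum>i\<le>N. of_rat (c i) * b ^ i) * z)"
      by (simp add: coeff additive_of_rat_mult[OF \<psi>(1)] sum sum_distrib_right mult.assoc)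
    finally show ?thesis by (simp add: c(2) zero)
  qed
  from eigenfunctional_of_annihilator[OF \<open>p \<noteq> 0\<close> \<psi>(2) this] obtain g s where g:
    "\<exists>z. (\<Sum>i\<le>degree g. coeff g i * \<psi> (b ^ i * z)) \<noteq> 0"
    "\<And>z. (\<Sum>i\<le>degree g. coeff g i * \<psi> (b ^ i * (b * z))) =
         s * (\<Sum>i\<le>degree g. coeff g i * \<psi> (b ^ i * z))" by blast
  define \<chi> where "\<chi> z = (\<Sum>i\<le>degree g. coeff g i * \<psi> (b ^ i * z))" for z
  have "additive \<chi>"
    by unfold_locales (simp add: \<chi>_def distrib_left add sum.distrib)
  \<comment> \<open>\<open>\<chi>\<close> combines the functionals
    \<open>z \<mapsto> \<psi> (b ^ i * z)\<close>, and \<open>b ^ i\<close> commutes with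
    \<open>y\<close>.\<close>
  moreover have keep: "\<chi> (y * z) = t * \<chi> z" if "\<And>z. \<psi> (y * z) = t * \<psi> z" for y t z
  proof -
    have "\<psi> (b ^ i * (y * z)) = t * \<psi> (b ^ i * z)" for i
      using that[of "b ^ i * z"] by (simp add: mult_ac)
    then show ?thesis by (simp add: \<chi>_def sum_distrib_left mult_ac)
  qed
  moreover have "\<forall>a\<in>insert b B. \<exists>s. \<forall>z. \<chi> (a * z) = s * \<chi> z"
  proof
    fix a assume "a \<in> insert b B"
    then consider "a = b" | "a \<in> B" by blast
    then show "\<exists>s. \<forall>z. \<chi> (a * z) = s * \<chi> z"
    proof cases
      case 1
      then show ?thesis using g(2) unfolding \<chi>_def by blast
    next
      case 2
      then obtain t where "\<And>z. \<psi> (a * z) = t * \<psi> z" using \<psi>(3) by blast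
      from keep[OF this] show ?thesis by blast
    qed
  qed
  moreover have "\<exists>z. \<chi> z \<noteq> 0" using g(1) by (simp add: \<chi>_def)
  moreover have "\<forall>y s. (\<forall>z. \<phi> (y * z) = s * \<phi> z) \<longrightarrow> (\<forall>z. \<chi> (y * z) = s * \<chi> z)"
    using \<psi>(4) keep by simp
  ultimately show ?case by blast
qed

text \<open>For a nonzero functional that is an eigenvector of all multiplications, the eigenvalue
  is additive and multiplicative in the multiplier, hence an embedding.\<close>

lemma field_hom_of_eigenfunctional:
  fixes \<phi> :: "'k::field_char_0 \<Rightarrow> complex"
  assumes fin: "finite_over_rat (UNIV :: 'k set)"
    and "additive \<phi>" "\<phi> w \<noteq> 0" "\<And>z. \<phi> (x * z) = r * \<phi> z"
  obtains \<sigma> where "is_field_hom \<sigma>" "\<sigma> x = r"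
proof -
  obtain B :: "'k set" where B: "finite B" "rat_vec.span B = UNIV"
    using fin unfolding finite_over_rat_def by blast
  obtain \<psi> u where \<psi>: "additive \<psi>" "\<psi> u \<noteq> 0" "\<forall>b\<in>B. \<exists>s. \<forall>z. \<psi> (b * z) = s * \<psi> z"
    "\<And>z. \<psi> (x * z) = r * \<psi> z"
    using common_eigenfunctional[OF fin B(1) assms(2,3)] assms(4) by metis
  interpret additive \<psi> by fact
  \<comment> \<open>The multipliers with an eigenvalue are closed under rational combinations, so
    \<open>B\<close> can be replaced by its span.\<close>
  have eigen: "\<exists>s. \<forall>z. \<psi> (y * z) = s * \<psi> z" for y
  proof -
    have "y \<in> rat_vec.span B" using B by simp
    then show ?thesis
    proof (induction rule: rat_vec.span_induct_alt)
      case base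
      then show ?case by (auto simp: zero intro!: exI[of _ 0])
    next
      case (step q b y)
      then obtain s t where "\<And>z. \<psi> (b * z) = s * \<psi> z" "\<And>z. \<psi> (y * z) = t * \<psi> z"
        using \<psi>(3) by metis
      then have "\<psi> ((of_rat q * b + y) * z) = (of_rat q * s + t) * \<psi> z" for z
        by (simp add: distrib_right add mult.assoc additive_of_rat_mult[OF \<psi>(1)])
      then show ?case by blast
    qed
  qed
  have "\<psi> 1 \<noteq> 0"
  proof -
    obtain s where "\<And>z. \<psi> (u * z) = s * \<psi> z" using eigen by blast
    from this[of 1] \<psi>(2) show ?thesis by auto
  qed
  \<comment> \<open>Evaluation at 1 forces this formula for the eigenvalue of
    \<open>y\<close>.\<close>
  define \<sigma> where "\<sigma> y = \<psi> y / \<psi> 1" for y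
  have \<sigma>: "\<psi> (y * z) = \<sigma> y * \<psi> z" for y z
  proof -
    obtain s where s: "\<And>z. \<psi> (y * z) = s * \<psi> z" using eigen by blast
    with s[of 1] \<open>\<psi> 1 \<noteq> 0\<close> show ?thesis by (simp add: \<sigma>_def)
  qed
  have "is_field_hom \<sigma>"
    unfolding is_field_hom_def using \<open>\<psi> 1 \<noteq> 0\<close> \<sigma>
    by (auto simp: \<sigma>_def add add_divide_distrib)
  moreover have "\<sigma> x = r"
    using \<psi>(4)[of 1] \<open>\<psi> 1 \<noteq> 0\<close> by (simp add: \<sigma>_def)
  ultimately show thesis by (rule that)
qed

section \<open>The trace form\<close>

lemma trace_mult_commute:
  fixes A B :: "'a::comm_semiring_0 mat"
  assumes "A \<in> carrier_mat n n" "B \<in> carrier_mat n n"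
  shows "(\<Sum>i<n. (A * B) $$ (i, i)) = (\<Sum>i<n. (B * A) $$ (i, i))"
proof -
  have "(\<Sum>i<n. (A * B) $$ (i, i)) = (\<Sum>i<n. \<Sum>k<n. A $$ (i, k) * B $$ (k, i))"
    using assms by (intro sum.cong) (auto simp: scalar_prod_def lessThan_atLeast0)
  also have "\<dots> = (\<Sum>k<n. \<Sum>i<n. B $$ (k, i) * A $$ (i, k))"
    by (subst sum.swap) (simp add: mult.commute)
  also have "\<dots> = (\<Sum>i<n. (B * A) $$ (i, i))"
    using assms by (intro sum.cong) (auto simp: scalar_prod_def lessThan_atLeast0)
  finally show ?thesis .
qed

text \<open>Schur triangularisation and the invariance of the trace under similarity reduce the
  trace to the sum of the squared eigenvalues.\<close>

lemma trace_square_real_eigenvalues: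
  fixes A :: "complex mat"
  assumes A: "A \<in> carrier_mat n n" and real: "\<And>e. eigenvalue A e \<Longrightarrow> e \<in> \<real>"
  obtains t :: real where "t \<ge> 0" "(\<Sum>i<n. (A * A) $$ (i, i)) = of_real t"
proof -
  obtain es where es: "char_poly A = (\<Prod>e\<leftarrow>es. [:- e, 1:])"
    using char_poly_factorized[OF A] by blast
  obtain B P Q where "schur_decomposition A es = (B, P, Q)" by (cases "schur_decomposition A es")
  from schur_decomposition[OF A es this]
  have wit: "similar_mat_wit A B P Q" and tri: "upper_triangular B" and diag: "diag_mat B = es"
    by blast+
  note w = similar_mat_witD2[OF A wit]
  have "A * A = A ^\<^sub>m 2" using A by (simp add: numeral_2_eq_2)
  also have "\<dots> = P * B ^\<^sub>m 2 * Q" by (rule similar_mat_wit_pow_id[OF wit])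
  also have "B ^\<^sub>m 2 = B * B" using w(5) by (simp add: numeral_2_eq_2)
  finally have "(\<Sum>i<n. (A * A) $$ (i, i)) = (\<Sum>i<n. (P * (B * B) * Q) $$ (i, i))" by simp
  also have "\<dots> = (\<Sum>i<n. (Q * (P * (B * B))) $$ (i, i))"
    using w by (intro trace_mult_commute) auto
  also have "Q * (P * (B * B)) = B * B"
    using w by (simp add: assoc_mult_mat[symmetric, of Q n n P n "B * B" n])
  also have "(\<Sum>i<n. (B * B) $$ (i, i)) = (\<Sum>i<n. (B $$ (i, i))\<^sup>2)"
  proof (intro sum.cong refl)
    fix i assume "i \<in> {..<n}"
    then have i: "i < n" by simp
    have "(B * B) $$ (i, i) = (\<Sum>k<n. B $$ (i, k) * B $$ (k, i))"
      using w(5) i by (simp add: scalar_prod_def lessThan_atLeast0)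
    \<comment> \<open>For \<open>k \<noteq> i\<close> one of the two factors lies below the diagonal
      and vanishes.\<close>
    also have "\<dots> = (\<Sum>k<n. if k = i then (B $$ (i, i))\<^sup>2 else 0)"
      using upper_triangularD[OF tri] w(5) i
      by (intro sum.cong) (auto simp: power2_eq_square neq_iff)
    finally show "(B * B) $$ (i, i) = (B $$ (i, i))\<^sup>2" using i by simp
  qed
  also have "\<dots> = of_real (\<Sum>i<n. (Re (B $$ (i, i)))\<^sup>2)"
  proof -
    have "B $$ (i, i) \<in> \<real>" if "i < n" for i
    proof (rule real)
      have "B $$ (i, i) \<in> set es"
        using that w(5) unfolding diag[symmetric] diag_mat_def by auto
      then have "poly (char_poly A) (B $$ (i, i)) = 0"
        unfolding es poly_prod_list prod_list_zero_iff by auto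
      then show "eigenvalue A (B $$ (i, i))" by (simp add: eigenvalue_root_char_poly[OF A])
    qed
    then show ?thesis by (simp add: of_real_Re)
  qed
  finally show thesis by (intro that[of "\<Sum>i<n. (Re (B $$ (i, i)))\<^sup>2"]) (simp_all add: sum_nonneg)
qed

text \<open>The trace is rational because multiplication is written in a rational basis; its sign on
  squares is read off from the complex eigenvalues of the same matrix.\<close>

lemma totally_real_positive_functional:
  assumes K: "totally_real_number_field TYPE('k::field_char_0)"
  obtains l :: "'k::field_char_0 \<Rightarrow> rat" where "additive l" "l 1 = 1" "\<forall>x. l (x * x) \<ge> 0"
proof -
  note K' = K[unfolded totally_real_number_field_def]
  have fin: "finite_over_rat (UNIV :: 'k set)"
    using K' by (rule conjunct1)
  have real: "range \<sigma> \<subseteq> \<real>" if "is_field_hom \<sigma>" for \<sigma> :: "'k \<Rightarrow> complex"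
    using conjunct2[OF K', rule_format, OF that] .
  obtain B :: "'k set" where B: "rat_vec.independent B" "UNIV \<subseteq> rat_vec.span B"
    by (rule rat_vec.basis_exists)
  then have span: "rat_vec.span B = UNIV" by (simp add: top.extremum_unique)
  have finB: "finite B"
  proof -
    obtain S :: "'k set" where "finite S" "rat_vec.span S = UNIV"
      using fin unfolding finite_over_rat_def by blast
    then show ?thesis using rat_vec.independent_span_bound[OF _ B(1), of S] by simp
  qed
  define d where "d = card B"
  obtain b where b: "bij_betw b {..<d} B"
    using ex_bij_betw_nat_finite[OF finB] by (auto simp: d_def lessThan_atLeast0)
  have bB: "b i \<in> B" if "i < d" for i using b that by (auto simp: bij_betw_def)
  define c where "c x i = rat_vec.representation B x (b i)" for x i
  have c_add: "c (x + y) i = c x i + c y i" for x y i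
    unfolding c_def using B(1) span by (simp add: rat_vec.representation_add)
  have c_scale: "c (of_rat q * x) i = q * c x i" for q x i
    unfolding c_def using B(1) span by (simp add: rat_vec.representation_scale)
  have c_basis: "c (b i) j = (if i = j then 1 else 0)" if "i < d" "j < d" for i j
    unfolding c_def rat_vec.representation_basis[OF B(1) bB[OF that(1)]]
    using b that by (auto simp: bij_betw_def inj_on_eq_iff)
  interpret c: additive "\<lambda>x. c x i" for i
    by unfold_locales (rule c_add)
  have expand: "x = (\<Sum>i<d. of_rat (c x i) * b i)" for x
  proof -
    have "x = (\<Sum>v\<in>B. of_rat (rat_vec.representation B x v) * v)"
      using rat_vec.sum_representation_eq[OF B(1), of x B] span finB by simp
    also have "\<dots> = (\<Sum>i<d. of_rat (c x i) * b i)"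
      unfolding c_def by (rule sum.reindex_bij_betw[OF b, symmetric])
    finally show ?thesis .
  qed
  \<comment> \<open>Row \<open>i\<close> holds the coordinates of \<open>x * b i\<close>, the
    transpose of the usual convention, so that eigenvectors correspond to functionals on the field
    rather than to its elements.\<close>
  define M :: "'k \<Rightarrow> complex mat" where "M x = mat d d (\<lambda>(i, j). of_rat (c (x * b i) j))" for x
  have M: "M x \<in> carrier_mat d d" for x by (simp add: M_def)
  have M_mult: "M x * M y = M (x * y)" for x y
  proof (rule eq_matI)
    fix i j assume "i < dim_row (M (x * y))" "j < dim_col (M (x * y))"
    then have ij: "i < d" "j < d" by (simp_all add: M_def)
    have "x * y * b i = y * (\<Sum>k<d. of_rat (c (x * b i) k) * b k)"
      using expand[of "x * b i"] by (simp add: mult_ac)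
    also have "\<dots> = (\<Sum>k<d. of_rat (c (x * b i) k) * (y * b k))"
      by (simp add: sum_distrib_left mult_ac)
    finally have "c (x * y * b i) j = (\<Sum>k<d. c (x * b i) k * c (y * b k) j)"
      by (simp add: c.sum c_scale)
    with ij show "(M x * M y) $$ (i, j) = M (x * y) $$ (i, j)"
      by (simp add: M_def scalar_prod_def lessThan_atLeast0 of_rat_sum of_rat_mult)
  qed (simp_all add: M_def)
  have eigen: "e \<in> \<real>" if ev: "eigenvalue (M x) e" for x e
  proof -
    obtain v where "eigenvector (M x) v e" using ev unfolding eigenvalue_def by blast
    then have v: "v \<in> carrier_vec d" "v \<noteq> 0\<^sub>v d" "M x *\<^sub>v v = e \<cdot>\<^sub>v v"
      unfolding eigenvector_def carrier_matD(1)[OF M] by blast+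
    \<comment> \<open>The linear functional with value \<open>v $ j\<close> at \<open>b j\<close>;
      the eigenvector equation says that it is an eigenfunctional for multiplication by
      \<open>x\<close>.\<close>
    define \<phi> where "\<phi> z = (\<Sum>j<d. of_rat (c z j) * v $ j)" for z
    have add: "additive \<phi>"
      by unfold_locales (simp add: \<phi>_def c_add of_rat_add distrib_right sum.distrib)
    interpret \<phi>: additive \<phi> by fact
    have \<phi>_basis: "\<phi> (b i) = v $ i" if "i < d" for i
    proof -
      have "\<phi> (b i) = (\<Sum>j<d. if j = i then v $ i else 0)"
        unfolding \<phi>_def using that by (intro sum.cong) (auto simp: c_basis)
      with that show ?thesis by simp
    qed
    obtain i where i: "i < d" "v $ i \<noteq> 0" using v(1,2) by (auto simp: vec_eq_iff)
    have "\<phi> (x * b i) = e * v $ i" if "i < d" for i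
    proof -
      have "\<phi> (x * b i) = (M x *\<^sub>v v) $ i"
        using that v(1) by (simp add: \<phi>_def M_def scalar_prod_def lessThan_atLeast0)
      with that v(1,3) show ?thesis by simp
    qed
    then have "\<phi> (x * z) = e * \<phi> z" for z
    proof -
      have "\<phi> (x * z) = \<phi> (\<Sum>i<d. of_rat (c z i) * (x * b i))"
        by (subst expand[of z]) (simp add: sum_distrib_left mult_ac)
      also have "\<dots> = (\<Sum>i<d. of_rat (c z i) * (e * v $ i))"
        using \<open>\<And>i. i < d \<Longrightarrow> \<phi> (x * b i) = e * v $ i\<close>
        by (simp add: \<phi>.sum additive_of_rat_mult[OF add])
      also have "\<dots> = e * \<phi> z" by (simp add: \<phi>_def sum_distrib_left mult_ac)
      finally show ?thesis .
    qed
    moreover have "\<phi> (b i) \<noteq> 0" using i \<phi>_basis by simp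
    ultimately obtain \<sigma> where "is_field_hom \<sigma>" "\<sigma> x = e"
      using field_hom_of_eigenfunctional[OF fin add, where x = x and r = e] by blast
    with real[of \<sigma>] show ?thesis by auto
  qed
  define tr where "tr x = (\<Sum>i<d. c (x * b i) i)" for x
  have tr_add: "tr (x + y) = tr x + tr y" for x y
    by (simp add: tr_def distrib_right c_add sum.distrib)
  have tr_nonneg: "tr (x * x) \<ge> 0" for x
  proof -
    obtain t where t: "t \<ge> 0" "(\<Sum>i<d. (M x * M x) $$ (i, i)) = of_real t"
      using trace_square_real_eigenvalues[OF M eigen] .
    \<comment> \<open>Rationals embed in the complex numbers equally directly and through the reals,
      so the sign of the complex trace can be pulled back.\<close>
    have "of_real (of_rat q) = (of_rat q :: complex)" for q
      using additive_of_rat_mult[of "of_real :: real \<Rightarrow> complex" q 1] by (simp add: additive_def)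
    then have "of_real (of_rat (tr (x * x))) = (of_rat (tr (x * x)) :: complex)" .
    also have "\<dots> = (\<Sum>i<d. (M x * M x) $$ (i, i))"
      unfolding M_mult by (simp add: tr_def M_def of_rat_sum)
    also note t(2)
    finally have "of_rat (tr (x * x)) = t" by (simp only: of_real_eq_iff)
    with t(1) show ?thesis by (metis zero_le_of_rat_iff)
  qed
  \<comment> \<open>Dividing by this value normalises the functional at 1.\<close>
  have "tr 1 = of_nat d" by (simp add: tr_def c_basis)
  moreover have "d \<noteq> 0"
  proof
    assume "d = 0"
    then show False using expand[of 1] by simp
  qed
  ultimately show thesis
    by (intro that[of "\<lambda>x. tr x / of_nat d"])
      (auto simp: additive_def tr_add tr_nonneg add_divide_distrib)
qed

section \<open>Descent along the tensor product\<close>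

lemma scaleQ_zero_left [simp]: "0 *\<^sub>Q (a::'a::comm_rat_algebra) = 0"
  using scaleQ_add_left[of 0 0 a] by simp

lemma scaleQ_zero_right [simp]: "q *\<^sub>Q (0::'a::comm_rat_algebra) = 0"
  using scaleQ_add_right[of q 0 0] by simp

lemma scaleQ_power2: "(q *\<^sub>Q (a::'a::comm_rat_algebra))\<^sup>2 = q\<^sup>2 *\<^sub>Q a\<^sup>2"
  by (simp add: power2_eq_square scaleQ_mult_left scaleQ_mult_right scaleQ_scaleQ)

section \<open>Closure properties of sums of squares\<close>

lemma is_sum_of_squares_0 [simp]: "is_sum_of_squares 0 f \<longleftrightarrow> f = 0"
  by (simp add: is_sum_of_squares_def)

lemma is_sum_of_squares_Suc:
  "is_sum_of_squares (Suc n) f \<longleftrightarrow> (\<exists>g h. is_sum_of_squares n g \<and> f = g + h\<^sup>2)"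
proof
  assume "is_sum_of_squares (Suc n) f"
  then show "\<exists>g h. is_sum_of_squares n g \<and> f = g + h\<^sup>2"
    unfolding is_sum_of_squares_def by (metis sum.lessThan_Suc)
next
  assume "\<exists>g h. is_sum_of_squares n g \<and> f = g + h\<^sup>2"
  then obtain p h where "f = (\<Sum>i<n. (p i)\<^sup>2) + h\<^sup>2"
    unfolding is_sum_of_squares_def by blast
  then have "f = (\<Sum>i<Suc n. ((p(n := h)) i)\<^sup>2)" by simp
  then show "is_sum_of_squares (Suc n) f" unfolding is_sum_of_squares_def by blast
qed

lemma is_sum_of_squares_add:
  assumes "is_sum_of_squares m f" "is_sum_of_squares n g"
  shows "is_sum_of_squares (m + n) (f + g)"
  using assms(2)
proof (induction n arbitrary: g)
  case (Suc n)
  then obtain g' h where "is_sum_of_squares n g'" "g = g' + h\<^sup>2"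
    by (auto simp: is_sum_of_squares_Suc)
  with Suc.IH show ?case by (auto simp: is_sum_of_squares_Suc add.assoc[symmetric])
qed (use assms(1) in simp)

lemma is_sum_of_squares_zero: "is_sum_of_squares n 0"
  unfolding is_sum_of_squares_def by (intro exI[of _ "\<lambda>_. 0"]) (simp add: power2_eq_square)

lemma is_sum_of_squares_mono:
  assumes "is_sum_of_squares m f" "m \<le> n"
  shows "is_sum_of_squares n f"
  using is_sum_of_squares_add[OF assms(1) is_sum_of_squares_zero[of "n - m"]] assms(2) by simp

lemma is_sum_of_squares_sum:
  assumes "\<And>i. i \<in> A \<Longrightarrow> is_sum_of_squares n (f i)"
  shows "is_sum_of_squares (card A * n) (\<Sum>i\<in>A. f i)"
  using assms
  by (induction A rule: infinite_finite_induct) (simp_all add: is_sum_of_squares_add)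

text \<open>Each of the four rational squares in \<open>q\<close> is absorbed into the square of a
  scalar multiple of \<open>r\<close>.\<close>

lemma is_sum_of_squares_scaleQ_square:
  assumes "0 \<le> q"
  shows "is_sum_of_squares 4 (q *\<^sub>Q (r::'r::comm_rat_algebra)\<^sup>2)"
proof -
  obtain a b c d where "q = a\<^sup>2 + b\<^sup>2 + c\<^sup>2 + d\<^sup>2" using nonneg_rat_four_squares[OF assms] .
  \<comment> \<open>The leading 0 is the empty sum left after \<open>is_sum_of_squares_Suc\<close>
    peels off four squares; dropping \<open>add_0\<close> from the simplifier keeps it in
    place.\<close>
  then have "q *\<^sub>Q r\<^sup>2 = 0 + (a *\<^sub>Q r)\<^sup>2 + (b *\<^sub>Q r)\<^sup>2 + (c *\<^sub>Q r)\<^sup>2 + (d *\<^sub>Q r)\<^sup>2"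
    by (simp add: scaleQ_power2 scaleQ_add_left)
  then show ?thesis
    by (auto simp: numeral_eq_Suc is_sum_of_squares_Suc simp del: add_0)
qed

lemma additive_rat_mult:
  fixes l :: "'k::field_char_0 \<Rightarrow> rat"
  assumes "additive l"
  shows "l (of_rat q * x) = q * l x"
  using additive_of_rat_mult[OF assms, of q x] by simp

section \<open>Elementary tensors and functionals on the tensor product\<close>

lemma tensor_of_add_right: "a \<otimes>\<^sub>Q (k + l) = a \<otimes>\<^sub>Q k + a \<otimes>\<^sub>Q l"
  using tensor_add_right[of a k l] by transfer (simp add: add_mset_commute)

lemma tensor_of_add_left: "(a + b) \<otimes>\<^sub>Q k = a \<otimes>\<^sub>Q k + b \<otimes>\<^sub>Q k"
  using tensor_add_left[of a b k] by transfer (simp add: add_mset_commute)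

lemma tensor_of_scaleQ: "(q *\<^sub>Q a) \<otimes>\<^sub>Q k = a \<otimes>\<^sub>Q (of_rat q * k)"
  by transfer (rule tensor_scale)

lemma tensor_of_zero_left: "0 \<otimes>\<^sub>Q k = 0"
  by transfer (rule tensor_zero)

lemma tensor_of_zero_right: "a \<otimes>\<^sub>Q 0 = 0"
  using tensor_of_scaleQ[of 0 a 0] by (simp add: tensor_of_zero_left)

lemma tensor_of_mult: "(a \<otimes>\<^sub>Q k) * (b \<otimes>\<^sub>Q l) = (a * b) \<otimes>\<^sub>Q (k * l)"
  by transfer (simp add: tensor_refl)

lemma tensor_of_sum_right: "a \<otimes>\<^sub>Q (\<Sum>i\<in>A. k i) = (\<Sum>i\<in>A. a \<otimes>\<^sub>Q k i)"
  by (induction A rule: infinite_finite_induct)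
    (simp_all add: tensor_of_zero_right tensor_of_add_right)

text \<open>Field components are expanded along \<open>C\<close>, and the rational coefficients move
  across the tensor sign into the algebra.\<close>

lemma tensor_expand:
  fixes t :: "('r::comm_rat_algebra, 'k::field_char_0) tensor"
  assumes C: "finite C" "rat_vec.span C = (UNIV :: 'k set)"
  obtains r where "t = (\<Sum>c\<in>C. r c \<otimes>\<^sub>Q c)"
proof -
  have "\<exists>r. abs_tensor X = (\<Sum>c\<in>C. r c \<otimes>\<^sub>Q c)" for X :: "('r \<times> 'k) multiset"
  proof (induction X)
    case empty
    have "abs_tensor {#} = (\<Sum>c\<in>C. (0::'r) \<otimes>\<^sub>Q c)"
      by (simp add: tensor_of_zero_left flip: zero_tensor_def)
    then show ?case by (intro exI[of _ "\<lambda>_. 0"])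
  next
    case (add x X)
    obtain a k where x: "x = (a, k)" by force
    obtain r where r: "abs_tensor X = (\<Sum>c\<in>C. r c \<otimes>\<^sub>Q c)" using add by blast
    have "k \<in> rat_vec.span C" using C by simp
    then obtain q where k: "k = (\<Sum>c\<in>C. of_rat (q c) * c)"
      unfolding rat_vec.span_finite[OF C(1)] by blast
    have "abs_tensor (add_mset x X) = a \<otimes>\<^sub>Q k + abs_tensor X"
      by (simp add: x tensor_of.abs_eq plus_tensor.abs_eq)
    also have "\<dots> = (\<Sum>c\<in>C. (q c *\<^sub>Q a + r c) \<otimes>\<^sub>Q c)"
      unfolding r k tensor_of_sum_right
      by (simp add: tensor_of_add_left tensor_of_scaleQ sum.distrib)
    finally show ?case by (intro exI[of _ "\<lambda>c. q c *\<^sub>Q a + r c"])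
  qed
  then have "\<exists>r. t = (\<Sum>c\<in>C. r c \<otimes>\<^sub>Q c)"
    by (induction t rule: tensor.abs_induct)
  then show thesis using that by blast
qed

text \<open>This is the map \<open>id \<otimes> l\<close>: it is defined on formal sums and descends
  because it respects every generating relation of \<open>tensor_eq\<close>.\<close>

lemma functional_tensor_extension:
  fixes l :: "'k::field_char_0 \<Rightarrow> rat"
  assumes "additive l"
  shows "\<exists>\<Lambda> :: ('r::comm_rat_algebra, 'k) tensor \<Rightarrow> 'r.
    additive \<Lambda> \<and> (\<forall>a k. \<Lambda> (a \<otimes>\<^sub>Q k) = l k *\<^sub>Q a)"
proof -
  interpret additive l by fact
  define L :: "('r \<times> 'k) multiset \<Rightarrow> 'r" where "L X = (\<Sum>x\<in>#X. l (snd x) *\<^sub>Q fst x)" for X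
  have L: "L X = L Y" if "tensor_eq X Y" for X Y
    using that
    by (induction rule: tensor_eq.induct)
      (simp_all add: L_def add scaleQ_add_left scaleQ_add_right scaleQ_scaleQ
        additive_rat_mult[OF assms] mult.commute[where 'a = rat])
  define \<Lambda> where "\<Lambda> t = L (rep_tensor t)" for t
  have \<Lambda>: "\<Lambda> (abs_tensor X) = L X" for X
    unfolding \<Lambda>_def by (rule L) (simp add: Quotient3_rep_abs[OF Quotient3_tensor] tensor_refl)
  have "additive \<Lambda>"
  proof
    fix s t :: "('r, 'k) tensor"
    show "\<Lambda> (s + t) = \<Lambda> s + \<Lambda> t"
      by (induction s rule: tensor.abs_induct, induction t rule: tensor.abs_induct)
        (simp add: plus_tensor.abs_eq \<Lambda> L_def)
  qed
  moreover have "\<Lambda> (a \<otimes>\<^sub>Q k) = l k *\<^sub>Q a" for a k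
    by (simp add: tensor_of.abs_eq \<Lambda> L_def)
  ultimately show ?thesis by (intro exI[of _ \<Lambda>]) simp
qed

text \<open>Gram-Schmidt without normalisation, so no square roots leave the rationals; positivity
  allows division by \<open>l (c * c)\<close>.\<close>

lemma orthogonal_span:
  fixes l :: "'k::field_char_0 \<Rightarrow> rat"
  assumes "additive l" and pos: "\<And>x. x \<noteq> 0 \<Longrightarrow> l (x * x) > 0" and "finite B"
  shows "\<exists>C. finite C \<and> card C \<le> card B \<and> B \<subseteq> rat_vec.span C \<and>
    (\<forall>c\<in>C. c \<noteq> 0) \<and> (\<forall>c\<in>C. \<forall>c'\<in>C. c \<noteq> c' \<longrightarrow> l (c * c') = 0)"
  using \<open>finite B\<close>
proof (induction B rule: finite_induct)
  case empty
  then show ?case by (intro exI[of _ "{}"]) simp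
next
  case (insert b B)
  then obtain C where C: "finite C" "card C \<le> card B" "B \<subseteq> rat_vec.span C"
    "\<forall>c\<in>C. c \<noteq> 0" "\<forall>c\<in>C. \<forall>c'\<in>C. c \<noteq> c' \<longrightarrow> l (c * c') = 0"
    by blast
  interpret additive l by fact
  \<comment> \<open>The orthogonal projection of \<open>b\<close> onto the span of
    \<open>C\<close>.\<close>
  define p where "p = (\<Sum>c\<in>C. of_rat (l (b * c) / l (c * c)) * c)"
  have p: "p \<in> rat_vec.span C" unfolding p_def
    by (intro rat_vec.span_sum rat_vec.span_scale rat_vec.span_base)
  show ?case
  \<comment> \<open>If \<open>b\<close> already lies in the span, \<open>b - p\<close> would be a
    zero vector and \<open>C\<close> is kept; hence only an inequality between
    cardinalities.\<close>
  proof (cases "b = p")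
    case True
    with C p insert.hyps show ?thesis by (intro exI[of _ C]) auto
  next
    case False
    let ?b = "b - p"
    have orth: "l (?b * c') = 0" "l (c' * ?b) = 0" if c': "c' \<in> C" for c'
    proof -
      have "l (p * c') = (\<Sum>c\<in>C. l (b * c) / l (c * c) * l (c * c'))"
        by (simp add: p_def sum_distrib_right sum mult.assoc additive_rat_mult[OF assms(1)])
      also have "\<dots> = (\<Sum>c\<in>C. if c = c' then l (b * c') else 0)"
        using C(4,5) c' pos[of c'] by (intro sum.cong) auto
      also have "\<dots> = l (b * c')" using C(1) c' by simp
      finally show "l (?b * c') = 0" by (simp add: left_diff_distrib diff)
      then show "l (c' * ?b) = 0" by (simp add: mult.commute)
    qed
    have "rat_vec.span C \<subseteq> rat_vec.span (insert ?b C)"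
      by (intro rat_vec.span_mono) auto
    moreover have "?b + p \<in> rat_vec.span (insert ?b C)"
      by (rule rat_vec.span_add) (use p calculation in \<open>auto intro: rat_vec.span_base\<close>)
    moreover have "card (insert ?b C) \<le> card (insert b B)"
      using C insert.hyps card_insert_le_m1 by (simp add: card_insert_if)
    ultimately show ?thesis
      using C False orth by (intro exI[of _ "insert ?b C"]) auto
  qed
qed

text \<open>The map \<open>id \<otimes> l\<close> sends \<open>f \<otimes> 1\<close> to
  \<open>f\<close> because \<open>l 1 = 1\<close>, and each square to at most \<open>card B\<close>
  squares with nonnegative rational weights; every weight costs a factor of four.\<close>

lemma sum_of_squares_descent:
  fixes l :: "'k::field_char_0 \<Rightarrow> rat" and f :: "'r::comm_rat_algebra"
  assumes "additive l" "l 1 = 1" and nonneg: "\<And>x. l (x * x) \<ge> 0"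
    and B: "finite B" "rat_vec.span B = (UNIV :: 'k set)"
    and f: "is_sum_of_squares m (f \<otimes>\<^sub>Q (1 :: 'k))"
  shows "is_sum_of_squares (m * (card B * 4)) f"
proof -
  interpret l: additive l by fact
  \<comment> \<open>Orthogonalisation needs a definite form. A nonzero isotropic \<open>x\<close>
    would still pair with its inverse to \<open>l 1 = 1\<close>, contradicting
    semidefiniteness.\<close>
  have pos: "l (x * x) > 0" if "x \<noteq> 0" for x
  proof (rule ccontr)
    assume "\<not> l (x * x) > 0"
    with nonneg[of x] have x: "l (x * x) = 0" by simp
    define y where "y = inverse x"
    \<comment> \<open>\<open>l ((y - t x)\<^sup>2) = l (y\<^sup>2) - 2 t\<close> is negative for large \<open>t\<close>.\<close>
    define t where "t = l (y * y) + 1"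
    have t: "t > 0" using nonneg[of y] by (simp add: t_def)
    have "(y - of_rat t * x) * (y - of_rat t * x)
        = y * y - of_rat (2 * t) * 1 + of_rat (t * t) * (x * x)"
      using that by (simp add: y_def algebra_simps of_rat_mult)
    then have "l ((y - of_rat t * x) * (y - of_rat t * x)) = l (y * y) - 2 * t"
      by (simp only: l.add l.diff additive_rat_mult[OF assms(1)] x assms(2))
    with nonneg[of "y - of_rat t * x"] nonneg[of y] show False by (simp add: t_def)
  qed
  obtain C where C: "finite C" "card C \<le> card B" "B \<subseteq> rat_vec.span C"
    and orth: "\<forall>c\<in>C. \<forall>c'\<in>C. c \<noteq> c' \<longrightarrow> l (c * c') = 0"
    using orthogonal_span[OF assms(1) pos B(1)] by blast
  have span: "rat_vec.span C = UNIV"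
    using C(3) B(2) rat_vec.span_minimal[OF C(3)] by auto
  obtain \<Lambda> :: "('r, 'k) tensor \<Rightarrow> 'r"
    where "additive \<Lambda> \<and> (\<forall>a k. \<Lambda> (a \<otimes>\<^sub>Q k) = l k *\<^sub>Q a)"
    using functional_tensor_extension[OF assms(1)] ..
  then have \<Lambda>: "additive \<Lambda>" "\<And>a k. \<Lambda> (a \<otimes>\<^sub>Q k) = l k *\<^sub>Q a" by simp_all
  interpret \<Lambda>: additive \<Lambda> by fact
  have square: "is_sum_of_squares (card B * 4) (\<Lambda> (p\<^sup>2))" for p
  proof -
    obtain r where r: "p = (\<Sum>c\<in>C. r c \<otimes>\<^sub>Q c)" using tensor_expand[OF C(1) span] .
    have "\<Lambda> (p\<^sup>2) = (\<Sum>c\<in>C. \<Sum>c'\<in>C. l (c * c') *\<^sub>Q (r c * r c'))"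
      by (simp add: r power2_eq_square sum_product tensor_of_mult \<Lambda>.sum \<Lambda>(2))
    \<comment> \<open>Orthogonality of \<open>C\<close> removes the mixed terms.\<close>
    also have "\<dots> = (\<Sum>c\<in>C. \<Sum>c'\<in>C. if c' = c then l (c * c) *\<^sub>Q (r c)\<^sup>2 else 0)"
      using orth by (intro sum.cong) (auto simp: power2_eq_square)
    also have "\<dots> = (\<Sum>c\<in>C. l (c * c) *\<^sub>Q (r c)\<^sup>2)" using C(1) by simp
    finally have "is_sum_of_squares (card C * 4) (\<Lambda> (p\<^sup>2))"
      by (simp add: is_sum_of_squares_sum is_sum_of_squares_scaleQ_square nonneg)
    with C(2) show ?thesis by (auto elim: is_sum_of_squares_mono)
  qed
  obtain p where "f \<otimes>\<^sub>Q (1::'k) = (\<Sum>i<m. (p i)\<^sup>2)"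
    using f unfolding is_sum_of_squares_def by blast
  then have "f = (\<Sum>i<m. \<Lambda> ((p i)\<^sup>2))"
    using \<Lambda>(2)[of f 1] by (simp add: assms(2) scaleQ_one \<Lambda>.sum)
  then show ?thesis
    using is_sum_of_squares_sum[of "{..<m}" "card B * 4" "\<lambda>i. \<Lambda> ((p i)\<^sup>2)"] square by simp
qed

section \<open>Degrees over the rationals and the final bound\<close>

lemma rat_degree_eq_card:
  assumes "finite_over_rat (UNIV :: 'a::field_char_0 set)"
  obtains B :: "'a::field_char_0 set" where "finite B" "rat_vec.independent B" "rat_vec.span B = UNIV"
    "rat_degree TYPE('a) = card B"
proof -
  obtain B :: "'a set" where B: "rat_vec.independent B" "UNIV \<subseteq> rat_vec.span B"
    "card B = rat_vec.dim (UNIV :: 'a set)"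
    by (rule rat_vec.basis_exists)
  obtain S :: "'a set" where "finite S" "rat_vec.span S = UNIV"
    using assms unfolding finite_over_rat_def by blast
  then have "finite B" using rat_vec.independent_span_bound[OF _ B(1), of S] by simp
  with B show thesis by (intro that[of B]) (auto simp: rat_degree_def)
qed

text \<open>A field homomorphism is injective and rational-linear, so it carries a basis to an
  independent set of the same size.\<close>

lemma rat_degree_field_hom_le:
  fixes h :: "'k::field_char_0 \<Rightarrow> 'l::field_char_0"
  assumes "is_field_hom h" "finite_over_rat (UNIV :: 'k set)" "finite_over_rat (UNIV :: 'l set)"
  shows "rat_degree TYPE('k) \<le> rat_degree TYPE('l)"
proof -
  have h_add: "additive h" and h: "h 1 = 1" "\<And>x y. h (x * y) = h x * h y"
    using assms(1) by (simp_all add: is_field_hom_def additive_def)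
  interpret additive h by fact
  have nz: "h x \<noteq> 0" if "x \<noteq> 0" for x
  proof
    assume "h x = 0"
    with h(2)[of x "inverse x"] that h(1) show False by simp
  qed
  have inj: "inj h"
    using nz diff by (intro injI) (metis eq_iff_diff_eq_0)
  obtain B :: "'k set" where B: "finite B" "rat_vec.independent B"
    "rat_degree TYPE('k) = card B"
    by (rule rat_degree_eq_card[OF assms(2)])
  obtain C :: "'l set" where C: "finite C" "rat_vec.span C = UNIV"
    "rat_degree TYPE('l) = card C"
    by (rule rat_degree_eq_card[OF assms(3)])
  have "rat_vec.independent (h ` B)"
  proof
    assume "rat_vec.dependent (h ` B)"
    then obtain u v where u: "v \<in> B" "u (h v) \<noteq> 0" "(\<Sum>w\<in>h ` B. of_rat (u w) * w) = 0"
      using B(1) by (auto simp: rat_vec.dependent_finite)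
    have "h (\<Sum>w\<in>B. of_rat (u (h w)) * w) = (\<Sum>w\<in>h ` B. of_rat (u w) * w)"
      using inj by (simp add: sum additive_of_rat_mult[OF h_add] sum.reindex inj_on_subset)
    with u(3) nz have "(\<Sum>w\<in>B. of_rat (u (h w)) * w) = 0" by metis
    with u(1,2) B(1,2) show False by (auto simp: rat_vec.dependent_finite)
  qed
  then have "card (h ` B) \<le> card C"
    using rat_vec.independent_span_bound[OF C(1), of "h ` B"] C(2) by simp
  then show ?thesis
    using inj B(3) C(3) by (simp add: card_image inj_on_subset)
qed

theorem theorem1p5:
  fixes f :: "'r::comm_rat_algebra"
    and \<iota> :: "'k::field_char_0 \<Rightarrow> 'l::field_char_0"
    and m :: nat
  assumes "totally_real_number_field TYPE('k)"
    and "is_galois_closure \<iota>"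
    and "is_sum_of_squares m (f \<otimes>\<^sub>Q (1 :: 'k))"
  shows "is_sum_of_squares
    (4 * m * 2 ^ (rat_degree TYPE('l) + 1) * ((rat_degree TYPE('l) + 1) choose 2)) f"
proof -
  let ?n = "rat_degree TYPE('l)"
  have fin: "finite_over_rat (UNIV :: 'k set)"
    using assms(1) by (simp add: totally_real_number_field_def)
  have "rat_degree TYPE('k) \<le> ?n"
    using rat_degree_field_hom_le[of \<iota>] fin assms(2)
    by (simp add: is_galois_closure_def galois_over_rat_def)
  moreover obtain B :: "'k set" where B: "finite B" "rat_vec.span B = UNIV"
    "rat_degree TYPE('k) = card B"
    by (rule rat_degree_eq_card[OF fin])
  ultimately have "card B \<le> ?n" by simp
  \<comment> \<open>Pascal's rule identifies this sum with the binomial coefficient in the claim, so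
    the \<open>4 * m * card B\<close> squares from the descent fit.\<close>
  also have "?n \<le> ?n + (?n choose 2)" by simp
  also have "\<dots> = (?n + 1) choose 2" by (simp add: numeral_2_eq_2)
  also have "\<dots> \<le> 2 ^ (?n + 1) * ((?n + 1) choose 2)" by simp
  finally have bound: "m * (card B * 4) \<le>
      4 * m * 2 ^ (?n + 1) * ((?n + 1) choose 2)" by simp
  obtain l :: "'k \<Rightarrow> rat" where l: "additive l" "l 1 = 1" "\<forall>x. l (x * x) \<ge> 0"
    by (rule totally_real_positive_functional[OF assms(1)])
  show ?thesis
    using sum_of_squares_descent[OF l(1,2) spec[OF l(3)] B(1,2) assms(3)] bound
    by (rule is_sum_of_squares_mono)
qed

end
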